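(* For every $\alpha\leq\omega$, the relation $\mathcal{M}^{\alpha}$ on closed $\mu$TCL terms is a congruence on the term algebra; that is, for every operation symbol $\mathsf{f}\colon \tau_1\times\cdots\times\tau_k\to\tau$ and closed terms $t_i,s_i$ of type $\tau_i$ with $\mathcal{M}^\alpha_{\tau_i}(t_i,s_i)$ ($i=1,\dots,k$), one has $\mathcal{M}^\alpha_\tau(\mathsf{f}(t_1,\dots,t_k),\mathsf{f}(s_1,\dots,s_k))$.
   Context: Types of $\mu$TCL: closed type expressions, modulo $\alpha$-equivalence, of the grammar $\tau::=\alpha\mid \tau_1\boxplus\tau_2\mid\tau_1\boxtimes\tau_2\mid \tau_1\Rightarrow\tau_2\mid \mu\alpha.\tau$. Closed terms are built from: constants $S_{\tau_1,\tau_2,\tau_3}\colon(\tau_1\Rightarrow\tau_2\Rightarrow\tau_3)\Rightarrow(\tau_1\Rightarrow\tau_2)\Rightarrow\tau_1\Rightarrow\tau_3$, $K_{\tau_1,\tau_2}\colon \tau_1\Rightarrow\tau_2\Rightarrow\tau_1$, $I_\tau\colon\tau\Rightarrow\tau$; operations $S'\colon(\tau_1\Rightarrow\tau_2\Rightarrow\tau_3)\to((\tau_1\Rightarrow\tau_2)\Rightarrow\tau_1\Rightarrow\tau_3)$, $S''\colon (\tau_1\Rightarrow\tau_2\Rightarrow\tau_3)\times(\tau_1\Rightarrow\tau_2)\to(\tau_1\Rightarrow\tau_3)$, $K'\colon\tau_1\to(\tau_2\Rightarrow\tau_1)$, application $t\,s$ of type $\tau_2$ for $t\colon\tau_1\Rightarrow\tau_2$,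 $s\colon\tau_1$, $\mathsf{inl}\colon\tau_1\to\tau_1\boxplus\tau_2$, $\mathsf{inr}\colon\tau_2\to\tau_1\boxplus\tau_2$, $\mathsf{case}\colon(\tau_1\boxplus\tau_2)\times(\tau_1\Rightarrow\tau_3)\times(\tau_2\Rightarrow\tau_3)\to\tau_3$, $\mathsf{pair}\colon\tau_1\times\tau_2\to\tau_1\boxtimes\tau_2$, $\mathsf{fst}\colon\tau_1\boxtimes\tau_2\to\tau_1$, $\mathsf{snd}\colon\tau_1\boxtimes\tau_2\to\tau_2$, $\mathsf{fold}_\tau\colon\tau[\mu\alpha.\tau/\alpha]\to\mu\alpha.\tau$, $\mathsf{unfold}_\tau\colon\mu\alpha.\tau\to\tau[\mu\alpha.\tau/\alpha]$. Transitions are exactly those derivable by: $S\xrightarrow{e}S'(e)$; $S'(t)\xrightarrow{e}S''(t,e)$; $S''(t,s)\xrightarrow{e}(t\,e)(s\,e)$; $K\xrightarrow{e}K'(e)$; $K'(t)\xrightarrow{e}t$; $I\xrightarrow{e}e$; $t\to t'\Rightarrow t\,s\to t'\,s$; $t\xrightarrow{s}t'\Rightarrow t\,s\to t'$; $\mathsf{inl}(t)\xrightarrow{\boxplus_1}t$; $\mathsf{inr}(t)\xrightarrow{\boxplus_2}t$; $t\to t'\Rightarrow\mathsf{case}(t,s,r)\to\mathsf{case}(t',s,r)$; $t\xrightarrow{\boxplus_1}t'\Rightarrow\mathsf{case}(t,s,r)\to s\,t'$; $t\xrightarrow{\boxplus_2}t'\Rightarrow\mathsf{case}(t,s,r)\to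 r\,t'$; $\mathsf{pair}(t,s)\xrightarrow{\boxtimes_1}t$; $\mathsf{pair}(t,s)\xrightarrow{\boxtimes_2}s$; $t\to t'\Rightarrow\mathsf{fst}(t)\to\mathsf{fst}(t'),\ \mathsf{snd}(t)\to\mathsf{snd}(t')$; $t\xrightarrow{\boxtimes_1}t'\Rightarrow\mathsf{fst}(t)\to t'$; $t\xrightarrow{\boxtimes_2}t'\Rightarrow\mathsf{snd}(t)\to t'$; $\mathsf{fold}(t)\xrightarrow{\mu}t$; $t\to t'\Rightarrow\mathsf{unfold}(t)\to\mathsf{unfold}(t')$; $t\xrightarrow{\mu}t'\Rightarrow\mathsf{unfold}(t)\to t'$. $\Rightarrow$ is the reflexive transitive closure of $\to$; $t\overset{l}{\Rightarrow}s$ iff $t\Rightarrow t'\xrightarrow{l}s$ for some $t'$. Extended weak transitions: for $t,s$ of type $\tau_1\Rightarrow\tau_2$ and $e$ of type $\tau_1$, $t\overset{e}{\Rrightarrow}s$ iff there is $t'$ with $t\Rightarrow t'$ and ($t'\xrightarrow{e}s$ or $s=t'\,e$); for all other labels $l\in\{\boxplus_1,\boxplus_2,\boxtimes_1,\boxtimes_2,\mu\}$, $t\overset{l}{\Rrightarrow}s$ iff $t\overset{l}{\Rightarrow}s$. For type-indexed relations $Q,R$: $\mathcal{E}(R)_\tau=\{(t,s)\mid t\to t'\implies\exists s'.\,s\Rightarrow s'\wedge R_\tau(t',s')\}$; $\mathcal{V}'_{\tau_1\boxplus\tau_2}(Q,R)=\{(t,s)\mid$ for $i=1,2$: $t\xrightarrow{\boxplus_i}t'\implies\exists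 s'.\,s\overset{\boxplus_i}{\Rrightarrow}s'\wedge R_{\tau_i}(t',s')\}$; $\mathcal{V}'_{\tau_1\boxtimes\tau_2}(Q,R)=\{(t,s)\mid t\xrightarrow{\boxtimes_1}t_1\wedge t\xrightarrow{\boxtimes_2}t_2\implies \exists s_1,s_2.\,s\overset{\boxtimes_1}{\Rrightarrow}s_1\wedge s\overset{\boxtimes_2}{\Rrightarrow}s_2\wedge R_{\tau_1}(t_1,s_1)\wedge R_{\tau_2}(t_2,s_2)\}$; $\mathcal{V}'_{\tau_1\Rightarrow\tau_2}(Q,R)=\{(t,s)\mid\forall e_1,e_2.\,Q_{\tau_1}(e_1,e_2)\wedge t\xrightarrow{e_1}t'\implies\exists s'.\,s\overset{e_2}{\Rrightarrow}s'\wedge R_{\tau_2}(t',s')\}$; $\mathcal{V}'_{\mu\alpha.\tau}(Q,R)=\{(t,s)\mid t\xrightarrow{\mu}t'\implies\exists s'.\,s\overset{\mu}{\Rrightarrow}s'\wedge R_{\tau[\mu\alpha.\tau/\alpha]}(t',s')\}$. $\mathcal{M}^0$ is the full relation, $\mathcal{M}^{n+1}=\mathcal{M}^n\cap\mathcal{E}(\mathcal{M}^n)\cap\mathcal{V}'(\mathcal{M}^n,\mathcal{M}^n)$, $\mathcal{M}^\omega=\bigcap_{n<\omega}\mathcal{M}^n$. *)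

theory Defs
  imports Main "HOL-Library.Extended_Nat"
begin

text \<open>
  Type expressions modulo alpha-equivalence, with de Bruijn indices: \<open>TMu\<close> binds index 0 of its body.
\<close>

datatype ty =
    TVar nat
  | TSum ty ty
  | TProd ty ty
  | TFun ty ty
  | TMu ty

primrec closed_at :: "nat \<Rightarrow> ty \<Rightarrow> bool" where
  "closed_at k (TVar i) \<longleftrightarrow> i < k"
| "closed_at k (TSum a b) \<longleftrightarrow> closed_at k a \<and> closed_at k b"
| "closed_at k (TProd a b) \<longleftrightarrow> closed_at k a \<and> closed_at k b"
| "closed_at k (TFun a b) \<longleftrightarrow> closed_at k a \<and> closed_at k b"
| "closed_at k (TMu a) \<longleftrightarrow> closed_at (Suc k) a"

abbreviation closed_ty :: "ty \<Rightarrow> bool" where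
  "closed_ty \<equiv> closed_at 0"

text \<open>
  \<open>tsubst k \<sigma> \<tau>\<close> replaces index \<open>k\<close> by \<open>\<sigma>\<close>. It is used for closed \<open>\<sigma>\<close> only, so no index of \<open>\<sigma>\<close>
  has to be shifted under a binder.
\<close>

primrec tsubst :: "nat \<Rightarrow> ty \<Rightarrow> ty \<Rightarrow> ty" where
  "tsubst k \<sigma> (TVar i) = (if i = k then \<sigma> else if k < i then TVar (i - 1) else TVar i)"
| "tsubst k \<sigma> (TSum a b) = TSum (tsubst k \<sigma> a) (tsubst k \<sigma> b)"
| "tsubst k \<sigma> (TProd a b) = TProd (tsubst k \<sigma> a) (tsubst k \<sigma> b)"
| "tsubst k \<sigma> (TFun a b) = TFun (tsubst k \<sigma> a) (tsubst k \<sigma> b)"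
| "tsubst k \<sigma> (TMu a) = TMu (tsubst (Suc k) \<sigma> a)"

abbreviation unroll :: "ty \<Rightarrow> ty" where
  "unroll \<tau> \<equiv> tsubst 0 (TMu \<tau>) \<tau>"

text \<open>
  The many-sorted signature. Each symbol carries all its type indices, so that it has a unique
  arity \<open>op_dom f\<close> and result sort \<open>op_cod f\<close>. The index of \<open>OFold\<close> and \<open>OUnfold\<close> is the body \<open>\<tau>\<close>
  of the recursive type \<open>TMu \<tau>\<close>.
\<close>

datatype opsym =
    OS ty ty ty | OS1 ty ty ty | OS2 ty ty ty
  | OK ty ty | OK1 ty ty
  | OI ty
  | OApp ty ty
  | OInl ty ty | OInr ty ty | OCase ty ty ty
  | OPair ty ty | OFst ty ty | OSnd ty ty
  | OFold ty | OUnfold ty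

primrec wf_op :: "opsym \<Rightarrow> bool" where
  "wf_op (OS a b c) \<longleftrightarrow> closed_ty a \<and> closed_ty b \<and> closed_ty c"
| "wf_op (OS1 a b c) \<longleftrightarrow> closed_ty a \<and> closed_ty b \<and> closed_ty c"
| "wf_op (OS2 a b c) \<longleftrightarrow> closed_ty a \<and> closed_ty b \<and> closed_ty c"
| "wf_op (OK a b) \<longleftrightarrow> closed_ty a \<and> closed_ty b"
| "wf_op (OK1 a b) \<longleftrightarrow> closed_ty a \<and> closed_ty b"
| "wf_op (OI a) \<longleftrightarrow> closed_ty a"
| "wf_op (OApp a b) \<longleftrightarrow> closed_ty a \<and> closed_ty b"
| "wf_op (OInl a b) \<longleftrightarrow> closed_ty a \<and> closed_ty b"
| "wf_op (OInr a b) \<longleftrightarrow> closed_ty a \<and> closed_ty b"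
| "wf_op (OCase a b c) \<longleftrightarrow> closed_ty a \<and> closed_ty b \<and> closed_ty c"
| "wf_op (OPair a b) \<longleftrightarrow> closed_ty a \<and> closed_ty b"
| "wf_op (OFst a b) \<longleftrightarrow> closed_ty a \<and> closed_ty b"
| "wf_op (OSnd a b) \<longleftrightarrow> closed_ty a \<and> closed_ty b"
| "wf_op (OFold a) \<longleftrightarrow> closed_ty (TMu a)"
| "wf_op (OUnfold a) \<longleftrightarrow> closed_ty (TMu a)"

primrec op_dom :: "opsym \<Rightarrow> ty list" where
  "op_dom (OS a b c) = []"
| "op_dom (OS1 a b c) = [TFun a (TFun b c)]"
| "op_dom (OS2 a b c) = [TFun a (TFun b c), TFun a b]"
| "op_dom (OK a b) = []"
| "op_dom (OK1 a b) = [a]"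
| "op_dom (OI a) = []"
| "op_dom (OApp a b) = [TFun a b, a]"
| "op_dom (OInl a b) = [a]"
| "op_dom (OInr a b) = [b]"
| "op_dom (OCase a b c) = [TSum a b, TFun a c, TFun b c]"
| "op_dom (OPair a b) = [a, b]"
| "op_dom (OFst a b) = [TProd a b]"
| "op_dom (OSnd a b) = [TProd a b]"
| "op_dom (OFold a) = [unroll a]"
| "op_dom (OUnfold a) = [TMu a]"

primrec op_cod :: "opsym \<Rightarrow> ty" where
  "op_cod (OS a b c) = TFun (TFun a (TFun b c)) (TFun (TFun a b) (TFun a c))"
| "op_cod (OS1 a b c) = TFun (TFun a b) (TFun a c)"
| "op_cod (OS2 a b c) = TFun a c"
| "op_cod (OK a b) = TFun a (TFun b a)"
| "op_cod (OK1 a b) = TFun b a"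
| "op_cod (OI a) = TFun a a"
| "op_cod (OApp a b) = b"
| "op_cod (OInl a b) = TSum a b"
| "op_cod (OInr a b) = TSum a b"
| "op_cod (OCase a b c) = c"
| "op_cod (OPair a b) = TProd a b"
| "op_cod (OFst a b) = a"
| "op_cod (OSnd a b) = b"
| "op_cod (OFold a) = TMu a"
| "op_cod (OUnfold a) = unroll a"

datatype trm = Op opsym "trm list"

inductive has_type :: "trm \<Rightarrow> ty \<Rightarrow> bool" (infix ":::" 50) where
  "wf_op f \<Longrightarrow> list_all2 has_type ts (op_dom f) \<Longrightarrow> Op f ts ::: op_cod f"

abbreviation "cS a b c \<equiv> Op (OS a b c) []"
abbreviation "cS1 a b c t \<equiv> Op (OS1 a b c) [t]"
abbreviation "cS2 a b c t s \<equiv> Op (OS2 a b c) [t, s]"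
abbreviation "cK a b \<equiv> Op (OK a b) []"
abbreviation "cK1 a b t \<equiv> Op (OK1 a b) [t]"
abbreviation "cI a \<equiv> Op (OI a) []"
abbreviation "App a b t s \<equiv> Op (OApp a b) [t, s]"
abbreviation "inl a b t \<equiv> Op (OInl a b) [t]"
abbreviation "inr a b t \<equiv> Op (OInr a b) [t]"
abbreviation "Case a b c t s r \<equiv> Op (OCase a b c) [t, s, r]"
abbreviation "pair a b t s \<equiv> Op (OPair a b) [t, s]"
abbreviation "pfst a b t \<equiv> Op (OFst a b) [t]"
abbreviation "psnd a b t \<equiv> Op (OSnd a b) [t]"
abbreviation "fold_tm a t \<equiv> Op (OFold a) [t]"
abbreviation "unfold_tm a t \<equiv> Op (OUnfold a) [t]"

datatype label = LArg trm | LSum1 | LSum2 | LProd1 | LProd2 | LMu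

text \<open>
  All labelled rules are axioms, so the labelled transitions can be defined before the unlabelled
  ones. Both are used on well-typed sources only; labels of function type are closed terms of the
  argument type.
\<close>

inductive lstep :: "trm \<Rightarrow> label \<Rightarrow> trm \<Rightarrow> bool" where
  S: "e ::: TFun a (TFun b c) \<Longrightarrow> lstep (cS a b c) (LArg e) (cS1 a b c e)"
| S1: "e ::: TFun a b \<Longrightarrow> lstep (cS1 a b c t) (LArg e) (cS2 a b c t e)"
| S2: "e ::: a \<Longrightarrow>
    lstep (cS2 a b c t s) (LArg e) (App b c (App a (TFun b c) t e) (App a b s e))"
| K: "e ::: a \<Longrightarrow> lstep (cK a b) (LArg e) (cK1 a b e)"
| K1: "e ::: b \<Longrightarrow> lstep (cK1 a b t) (LArg e) t"
| I: "e ::: a \<Longrightarrow> lstep (cI a) (LArg e) e"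
| inl: "lstep (inl a b t) LSum1 t"
| inr: "lstep (inr a b t) LSum2 t"
| pair1: "lstep (pair a b t s) LProd1 t"
| pair2: "lstep (pair a b t s) LProd2 s"
| fold: "lstep (fold_tm a t) LMu t"

inductive step :: "trm \<Rightarrow> trm \<Rightarrow> bool" where
  app: "step t t' \<Longrightarrow> step (App a b t s) (App a b t' s)"
| app_label: "lstep t (LArg s) t' \<Longrightarrow> step (App a b t s) t'"
| case_step: "step t t' \<Longrightarrow> step (Case a b c t s r) (Case a b c t' s r)"
| case_inl: "lstep t LSum1 t' \<Longrightarrow> step (Case a b c t s r) (App a c s t')"
| case_inr: "lstep t LSum2 t' \<Longrightarrow> step (Case a b c t s r) (App b c r t')"
| fst_step: "step t t' \<Longrightarrow> step (pfst a b t) (pfst a b t')"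
| snd_step: "step t t' \<Longrightarrow> step (psnd a b t) (psnd a b t')"
| fst_pair: "lstep t LProd1 t' \<Longrightarrow> step (pfst a b t) t'"
| snd_pair: "lstep t LProd2 t' \<Longrightarrow> step (psnd a b t) t'"
| unfold_step: "step t t' \<Longrightarrow> step (unfold_tm a t) (unfold_tm a t')"
| unfold_fold: "lstep t LMu t' \<Longrightarrow> step (unfold_tm a t) t'"

abbreviation weak :: "trm \<Rightarrow> trm \<Rightarrow> bool" where
  "weak \<equiv> step\<^sup>*\<^sup>*"

definition wlstep :: "trm \<Rightarrow> label \<Rightarrow> trm \<Rightarrow> bool" where
  "wlstep t l s \<longleftrightarrow> (\<exists>t'. weak t t' \<and> lstep t' l s)"

text \<open>The extended weak transitions: a weak transition labelled by a term may stop at the application.\<close>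

inductive ext_weak :: "trm \<Rightarrow> label \<Rightarrow> trm \<Rightarrow> bool" where
  weak: "wlstep t l s \<Longrightarrow> ext_weak t l s"
| app: "t ::: TFun a b \<Longrightarrow> e ::: a \<Longrightarrow> weak t t' \<Longrightarrow> ext_weak t (LArg e) (App a b t' e)"

type_synonym ty_rel = "ty \<Rightarrow> (trm \<times> trm) set"

definition full_rel :: ty_rel where
  "full_rel \<tau> = {t. t ::: \<tau>} \<times> {t. t ::: \<tau>}"

definition E_rel :: "ty_rel \<Rightarrow> ty_rel" where
  "E_rel R \<tau> = {(t, s) \<in> full_rel \<tau>.
     \<forall>t'. step t t' \<longrightarrow> (\<exists>s'. weak s s' \<and> (t', s') \<in> R \<tau>)}"

text \<open>There are no closed terms whose type is a variable; the value at \<open>TVar\<close> is irrelevant.\<close>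

primrec V_rel :: "ty_rel \<Rightarrow> ty_rel \<Rightarrow> ty_rel" where
  "V_rel Q R (TVar i) = {}"
| "V_rel Q R (TSum \<tau>1 \<tau>2) = {(t, s) \<in> full_rel (TSum \<tau>1 \<tau>2).
     (\<forall>t'. lstep t LSum1 t' \<longrightarrow> (\<exists>s'. ext_weak s LSum1 s' \<and> (t', s') \<in> R \<tau>1)) \<and>
     (\<forall>t'. lstep t LSum2 t' \<longrightarrow> (\<exists>s'. ext_weak s LSum2 s' \<and> (t', s') \<in> R \<tau>2))}"
| "V_rel Q R (TProd \<tau>1 \<tau>2) = {(t, s) \<in> full_rel (TProd \<tau>1 \<tau>2).
     \<forall>t1 t2. lstep t LProd1 t1 \<and> lstep t LProd2 t2 \<longrightarrow>
       (\<exists>s1 s2. ext_weak s LProd1 s1 \<and> ext_weak s LProd2 s2 \<and>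
          (t1, s1) \<in> R \<tau>1 \<and> (t2, s2) \<in> R \<tau>2)}"
| "V_rel Q R (TFun \<tau>1 \<tau>2) = {(t, s) \<in> full_rel (TFun \<tau>1 \<tau>2).
     \<forall>e1 e2 t'. (e1, e2) \<in> Q \<tau>1 \<and> lstep t (LArg e1) t' \<longrightarrow>
       (\<exists>s'. ext_weak s (LArg e2) s' \<and> (t', s') \<in> R \<tau>2)}"
| "V_rel Q R (TMu \<tau>) = {(t, s) \<in> full_rel (TMu \<tau>).
     \<forall>t'. lstep t LMu t' \<longrightarrow> (\<exists>s'. ext_weak s LMu s' \<and> (t', s') \<in> R (unroll \<tau>))}"

primrec M_fin :: "nat \<Rightarrow> ty_rel" where
  "M_fin 0 = full_rel"
| "M_fin (Suc n) = (\<lambda>\<tau>. M_fin n \<tau> \<inter> E_rel (M_fin n) \<tau> \<inter> V_rel (M_fin n) (M_fin n) \<tau>)"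

text \<open>The ordinals up to \<open>\<omega>\<close> are the elements of \<^typ>\<open>enat\<close>, with \<open>\<infinity>\<close> in the role of \<open>\<omega>\<close>.\<close>

definition M_rel :: "enat \<Rightarrow> ty_rel" where
  "M_rel \<alpha> \<tau> = (case \<alpha> of enat n \<Rightarrow> M_fin n \<tau> | \<infinity> \<Rightarrow> (\<Inter>n. M_fin n \<tau>))"

definition congruence :: "ty_rel \<Rightarrow> bool" where
  "congruence R \<longleftrightarrow>
     (\<forall>f ts ss. wf_op f \<and> length ts = length (op_dom f) \<and> length ss = length (op_dom f) \<and>
        (\<forall>i < length (op_dom f).
           ts ! i ::: op_dom f ! i \<and> ss ! i ::: op_dom f ! i \<and>
           (ts ! i, ss ! i) \<in> R (op_dom f ! i)) \<longrightarrow>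
        (Op f ts, Op f ss) \<in> R (op_cod f))"

end

theory Submission
  imports Defs
begin

text \<open>
  The operator \<open>R \<mapsto> R \<inter> \<E>(R) \<inter> \<V>'(R, R)\<close> preserves congruences. Eliminators have no labelled
  transitions and constructors and combinators have no unlabelled ones, so only one of \<open>\<E>\<close> and
  \<open>\<V>'\<close> matters for each symbol. A weak transition of the principal argument lifts to a weak transition
  of the eliminator; for application, an extended weak transition of \<open>s\<close> labelled \<open>e\<close> is always a weak
  transition of \<open>s e\<close>. The resulting terms are related because \<open>R\<close> is a congruence.
\<close>

section \<open>Inversion of transitions, and typing\<close>

inductive_cases
      lstep_LArgE [consumes 1, case_names S S1 S2 K K1 I]: "lstep t (LArg e) t'"
  and lstep_LSum1E: "lstep t LSum1 t'"
  and lstep_LSum2E: "lstep t LSum2 t'"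
  and lstep_LProd1E: "lstep t LProd1 t'"
  and lstep_LProd2E: "lstep t LProd2 t'"
  and lstep_LMuE: "lstep t LMu t'"

inductive_cases
      step_AppE [consumes 1, case_names arg label]: "step (App a b t s) u"
  and step_CaseE [consumes 1, case_names arg inl inr]: "step (Case a b c t s r) u"
  and step_pfstE [consumes 1, case_names arg label]: "step (pfst a b t) u"
  and step_psndE [consumes 1, case_names arg label]: "step (psnd a b t) u"
  and step_unfoldE [consumes 1, case_names arg label]: "step (unfold_tm a t) u"

lemma has_type_unique: "t ::: \<tau> \<Longrightarrow> t ::: \<tau>' \<Longrightarrow> \<tau> = \<tau>'"
  by (auto elim!: has_type.cases)

text \<open>Needed because \<open>V_rel\<close> is empty at variables. The result sorts other than
  \<open>unroll a\<close> are closed or visibly compound. For \<open>unroll a\<close> with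
  \<open>a\<close> a variable, closedness of \<open>TMu a\<close> forces index 0, and substitution
  replaces that variable by a \<open>TMu\<close>.\<close>

lemma op_cod_not_TVar: "wf_op f \<Longrightarrow> op_cod f \<noteq> TVar i"
proof (cases f)
  case (OUnfold a)
  moreover assume "wf_op f"
  ultimately show ?thesis by (cases a) auto
qed auto

lemma has_type_Op:
  assumes "wf_op f" "length ts = length (op_dom f)"
    "\<forall>i < length (op_dom f). ts ! i ::: op_dom f ! i"
  shows "Op f ts ::: op_cod f"
  using assms by (auto intro!: has_type.intros simp: list_all2_conv_all_nth)

section \<open>Lifting weak transitions of the principal argument to eliminators\<close>

lemma weak_App: "weak t t' \<Longrightarrow> weak (App a b t s) (App a b t' s)"
  by (induction rule: rtranclp_induct) (auto intro: rtranclp.rtrancl_into_rtrancl step.app)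

lemma weak_Case: "weak t t' \<Longrightarrow> weak (Case a b c t s r) (Case a b c t' s r)"
  by (induction rule: rtranclp_induct) (auto intro: rtranclp.rtrancl_into_rtrancl step.case_step)

lemma weak_pfst: "weak t t' \<Longrightarrow> weak (pfst a b t) (pfst a b t')"
  by (induction rule: rtranclp_induct) (auto intro: rtranclp.rtrancl_into_rtrancl step.fst_step)

lemma weak_psnd: "weak t t' \<Longrightarrow> weak (psnd a b t) (psnd a b t')"
  by (induction rule: rtranclp_induct) (auto intro: rtranclp.rtrancl_into_rtrancl step.snd_step)

lemma weak_unfold: "weak t t' \<Longrightarrow> weak (unfold_tm a t) (unfold_tm a t')"
  by (induction rule: rtranclp_induct) (auto intro: rtranclp.rtrancl_into_rtrancl step.unfold_step)

text \<open>This is where the extended transitions fit: stopping at the application is just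
  reduction of the function part, and a genuine labelled transition becomes one further step by
  \<open>step.app_label\<close>. In the first case \<open>ext_weak\<close> chooses its own type
  indices for the application, and uniqueness of types identifies them with \<open>a\<close> and
  \<open>b\<close>.\<close>

lemma ext_weak_App:
  assumes "ext_weak t (LArg e) u" "t ::: TFun a b"
  shows "weak (App a b t e) u"
  using assms(1)
proof cases
  case weak
  then show ?thesis unfolding wlstep_def
    by (meson weak_App step.app_label rtranclp.rtrancl_into_rtrancl)
next
  case (app a' b' t')
  with has_type_unique[OF assms(2)] show ?thesis
    by (auto intro: weak_App)
qed

lemma ext_weak_not_LArg: "(\<And>e. l \<noteq> LArg e) \<Longrightarrow> ext_weak t l u \<longleftrightarrow> wlstep t l u"
  by (auto elim: ext_weak.cases intro: ext_weak.weak)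

lemma ext_weak_Case1: "ext_weak t LSum1 u \<Longrightarrow> weak (Case a b c t s r) (App a c s u)"
  by (simp add: ext_weak_not_LArg wlstep_def)
    (meson weak_Case step.case_inl rtranclp.rtrancl_into_rtrancl)

lemma ext_weak_Case2: "ext_weak t LSum2 u \<Longrightarrow> weak (Case a b c t s r) (App b c r u)"
  by (simp add: ext_weak_not_LArg wlstep_def)
    (meson weak_Case step.case_inr rtranclp.rtrancl_into_rtrancl)

lemma ext_weak_pfst: "ext_weak t LProd1 u \<Longrightarrow> weak (pfst a b t) u"
  by (simp add: ext_weak_not_LArg wlstep_def)
    (meson weak_pfst step.fst_pair rtranclp.rtrancl_into_rtrancl)

lemma ext_weak_psnd: "ext_weak t LProd2 u \<Longrightarrow> weak (psnd a b t) u"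
  by (simp add: ext_weak_not_LArg wlstep_def)
    (meson weak_psnd step.snd_pair rtranclp.rtrancl_into_rtrancl)

lemma ext_weak_unfold: "ext_weak t LMu u \<Longrightarrow> weak (unfold_tm a t) u"
  by (simp add: ext_weak_not_LArg wlstep_def)
    (meson weak_unfold step.unfold_fold rtranclp.rtrancl_into_rtrancl)

lemma lstep_ext_weak: "lstep t l u \<Longrightarrow> ext_weak t l u"
  by (rule ext_weak.weak) (auto simp: wlstep_def)

lemma E_relD:
  "(t, s) \<in> E_rel R \<tau> \<Longrightarrow> step t t' \<Longrightarrow> \<exists>s'. weak s s' \<and> (t', s') \<in> R \<tau>"
  by (auto simp: E_rel_def)

section \<open>One stage of the chain over an arbitrary typed congruence\<close>

context
  fixes R :: ty_rel
  assumes cong: "congruence R" and typed: "\<And>\<tau>. R \<tau> \<subseteq> full_rel \<tau>"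
begin

lemma rel_typed:
  assumes "(t, s) \<in> R \<tau>"
  shows "t ::: \<tau>" "s ::: \<tau>"
  using assms typed[of \<tau>] by (auto simp: full_rel_def)

text \<open>The index-based premise of \<open>congruence\<close> is recast with
  \<open>list_all2\<close> and \<open>zip\<close> so that simplification reduces it to one
  membership per argument on concrete lists. The typing premises follow from
  \<open>rel_typed\<close>.\<close>

lemma rel_Op:
  assumes "wf_op f" "list_all2 (\<lambda>p \<tau>. p \<in> R \<tau>) (zip ts ss) (op_dom f)" "length ts = length ss"
  shows "(Op f ts, Op f ss) \<in> R (op_cod f)"
proof -
  have "length ss = length (op_dom f)" "length ts = length (op_dom f)"
    "\<forall>i < length (op_dom f). (ts ! i, ss ! i) \<in> R (op_dom f ! i)"
    using assms by (auto simp: list_all2_conv_all_nth)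
  with assms(1) cong show ?thesis
    unfolding congruence_def by (blast dest: rel_typed)
qed

lemma rel_App:
  assumes "closed_ty a" "closed_ty b" "(t, t') \<in> R (TFun a b)" "(s, s') \<in> R a"
  shows "(App a b t s, App a b t' s') \<in> R b"
  using rel_Op[of "OApp a b" "[t, s]" "[t', s']"] assms by simp

text \<open>The principal argument of an eliminator either steps, which \<open>E_rel\<close>
  answers, or is consumed through a label, which \<open>V_rel\<close> answers. The remaining
  arguments only have to be related by \<open>R\<close>.\<close>

lemma E_rel_Op:
  assumes wf: "wf_op f"
    and len: "length ts = length (op_dom f)" "length ss = length (op_dom f)"
    and args: "\<And>i. i < length (op_dom f) \<Longrightarrow> (ts ! i, ss ! i) \<in>
      R (op_dom f ! i) \<inter> E_rel R (op_dom f ! i) \<inter> V_rel R R (op_dom f ! i)"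
  shows "(Op f ts, Op f ss) \<in> E_rel R (op_cod f)"
proof -
  have "Op f ts ::: op_cod f" "Op f ss ::: op_cod f"
    using wf len args by (auto intro!: has_type_Op dest: rel_typed)
  moreover have "\<exists>s'. weak (Op f ss) s' \<and> (u, s') \<in> R (op_cod f)" if step: "step (Op f ts) u" for u
  proof (cases f)
    case (OApp a b)
    from OApp len obtain t1 e1 t2 e2 where eq: "ts = [t1, e1]" "ss = [t2, e2]"
      by (auto simp: length_Suc_conv numeral_2_eq_2)
    from OApp wf have cl: "closed_ty a" "closed_ty b" by auto
    have t: "(t1, t2) \<in> R (TFun a b)" "(t1, t2) \<in> E_rel R (TFun a b)"
        "(t1, t2) \<in> V_rel R R (TFun a b)"
      and e: "(e1, e2) \<in> R a"
      using args[of 0] args[of 1] OApp eq by auto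
    from step[unfolded OApp eq] show ?thesis
    proof (cases rule: step_AppE)
      case (arg t')
      with E_relD[OF t(2)] obtain t2' where "weak t2 t2'" "(t', t2') \<in> R (TFun a b)" by blast
      with arg e cl show ?thesis unfolding OApp eq
        by (auto intro!: weak_App rel_App)
    next
      case label
      \<comment> \<open>The operands \<open>e1\<close> and \<open>e2\<close> serve as the related
        pair of labels in the function clause of \<open>V_rel\<close>, so the right-hand side may
        answer with its own operand.\<close>
      with t(3) e obtain s' where "ext_weak t2 (LArg e2) s'" "(u, s') \<in> R b" by fastforce
      with ext_weak_App[OF _ rel_typed(2)[OF t(1)]] show ?thesis unfolding OApp eq by auto
    qed
  next
    case (OCase a b c)
    from OCase len obtain t1 p1 q1 t2 p2 q2 where eq: "ts = [t1, p1, q1]" "ss = [t2, p2, q2]"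
      by (auto simp: length_Suc_conv numeral_3_eq_3)
    from OCase wf have cl: "closed_ty a" "closed_ty b" "closed_ty c" by auto
    have t: "(t1, t2) \<in> E_rel R (TSum a b)" "(t1, t2) \<in> V_rel R R (TSum a b)"
      and p: "(p1, p2) \<in> R (TFun a c)" and q: "(q1, q2) \<in> R (TFun b c)"
      using args[of 0] args[of 1] args[of 2] OCase eq by auto
    from step[unfolded OCase eq] show ?thesis
    proof (cases rule: step_CaseE)
      case (arg t')
      with E_relD[OF t(1)] obtain t2' where "weak t2 t2'" "(t', t2') \<in> R (TSum a b)" by blast
      with arg p q wf rel_Op[of "OCase a b c" "[t', p1, q1]" "[t2', p2, q2]"]
      show ?thesis unfolding OCase eq by (auto intro!: weak_Case)
    next
      case (inl t')
      with t(2) obtain s' where "ext_weak t2 LSum1 s'" "(t', s') \<in> R a" by auto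
      \<comment> \<open>Both sides have become applications of a branch to the injected term;
        congruence for application relates them.\<close>
      with inl p cl show ?thesis unfolding OCase eq
        by (auto intro!: ext_weak_Case1 rel_App)
    next
      case (inr t')
      with t(2) obtain s' where "ext_weak t2 LSum2 s'" "(t', s') \<in> R b" by auto
      with inr q cl show ?thesis unfolding OCase eq
        by (auto intro!: ext_weak_Case2 rel_App)
    qed
  next
    case (OFst a b)
    from OFst len obtain t1 t2 where eq: "ts = [t1]" "ss = [t2]"
      by (auto simp: length_Suc_conv)
    have t: "(t1, t2) \<in> R (TProd a b)" "(t1, t2) \<in> E_rel R (TProd a b)"
        "(t1, t2) \<in> V_rel R R (TProd a b)"
      using args[of 0] OFst eq by auto
    from step[unfolded OFst eq] show ?thesis
    proof (cases rule: step_pfstE)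
      case (arg t')
      with E_relD[OF t(2)] obtain t2' where "weak t2 t2'" "(t', t2') \<in> R (TProd a b)" by blast
      with arg wf rel_Op[of "OFst a b" "[t']" "[t2']"] show ?thesis unfolding OFst eq
        by (auto simp: OFst intro!: weak_pfst)
    next
      case label
      \<comment> \<open>The product clause of \<open>V_rel\<close> applies only when both
        projections exist. A term with one of them is a pair and so has the other.\<close>
      then obtain v where "lstep t1 LProd2 v" by (auto elim: lstep_LProd1E intro: lstep.pair2)
      with label t(3) obtain s' where "ext_weak t2 LProd1 s'" "(u, s') \<in> R a" by auto
      then show ?thesis unfolding OFst eq by (auto intro!: ext_weak_pfst)
    qed
  next
    case (OSnd a b)
    from OSnd len obtain t1 t2 where eq: "ts = [t1]" "ss = [t2]"
      by (auto simp: length_Suc_conv)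
    have t: "(t1, t2) \<in> R (TProd a b)" "(t1, t2) \<in> E_rel R (TProd a b)"
        "(t1, t2) \<in> V_rel R R (TProd a b)"
      using args[of 0] OSnd eq by auto
    from step[unfolded OSnd eq] show ?thesis
    proof (cases rule: step_psndE)
      case (arg t')
      with E_relD[OF t(2)] obtain t2' where "weak t2 t2'" "(t', t2') \<in> R (TProd a b)" by blast
      with arg wf rel_Op[of "OSnd a b" "[t']" "[t2']"] show ?thesis unfolding OSnd eq
        by (auto simp: OSnd intro!: weak_psnd)
    next
      case label
      then obtain v where "lstep t1 LProd1 v" by (auto elim: lstep_LProd2E intro: lstep.pair1)
      with label t(3) obtain s' where "ext_weak t2 LProd2 s'" "(u, s') \<in> R b" by auto
      then show ?thesis unfolding OSnd eq by (auto intro!: ext_weak_psnd)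
    qed
  next
    case (OUnfold a)
    from OUnfold len obtain t1 t2 where eq: "ts = [t1]" "ss = [t2]"
      by (auto simp: length_Suc_conv)
    have t: "(t1, t2) \<in> E_rel R (TMu a)" "(t1, t2) \<in> V_rel R R (TMu a)"
      using args[of 0] OUnfold eq by auto
    from step[unfolded OUnfold eq] show ?thesis
    proof (cases rule: step_unfoldE)
      case (arg t')
      with E_relD[OF t(1)] obtain t2' where "weak t2 t2'" "(t', t2') \<in> R (TMu a)" by blast
      with arg wf rel_Op[of "OUnfold a" "[t']" "[t2']"] show ?thesis unfolding OUnfold eq
        by (auto simp: OUnfold intro!: weak_unfold)
    next
      case label
      with t(2) obtain s' where "ext_weak t2 LMu s'" "(u, s') \<in> R (unroll a)" by auto
      then show ?thesis unfolding OUnfold eq by (auto intro!: ext_weak_unfold)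
    qed
  qed (use step in \<open>auto elim: step.cases\<close>)
  ultimately show ?thesis by (auto simp: E_rel_def full_rel_def)
qed

text \<open>Constructors and combinators with the same head can answer a label at once, so it
  suffices to match strong transitions, and for products each projection separately. The third
  premise excludes the sorts at which \<open>V_rel\<close> is empty.\<close>

lemma V_relI:
  assumes "t ::: \<tau>" "s ::: \<tau>" "\<And>i. \<tau> \<noteq> TVar i"
    and "\<And>a b e1 e2 u. \<tau> = TFun a b \<Longrightarrow> (e1, e2) \<in> R a \<Longrightarrow> lstep t (LArg e1) u \<Longrightarrow>
      \<exists>v. lstep s (LArg e2) v \<and> (u, v) \<in> R b"
    and "\<And>a b u. \<tau> = TSum a b \<Longrightarrow> lstep t LSum1 u \<Longrightarrow> \<exists>v. lstep s LSum1 v \<and> (u, v) \<in> R a"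
    and "\<And>a b u. \<tau> = TSum a b \<Longrightarrow> lstep t LSum2 u \<Longrightarrow> \<exists>v. lstep s LSum2 v \<and> (u, v) \<in> R b"
    and "\<And>a b u. \<tau> = TProd a b \<Longrightarrow> lstep t LProd1 u \<Longrightarrow> \<exists>v. lstep s LProd1 v \<and> (u, v) \<in> R a"
    and "\<And>a b u. \<tau> = TProd a b \<Longrightarrow> lstep t LProd2 u \<Longrightarrow> \<exists>v. lstep s LProd2 v \<and> (u, v) \<in> R b"
    and "\<And>a u. \<tau> = TMu a \<Longrightarrow> lstep t LMu u \<Longrightarrow> \<exists>v. lstep s LMu v \<and> (u, v) \<in> R (unroll a)"
  shows "(t, s) \<in> V_rel R R \<tau>"
proof (cases \<tau>)
  case (TVar i)
  with assms(3) show ?thesis by blast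
next
  case (TSum a b)
  with assms(1,2,5,6) show ?thesis
    by (simp add: full_rel_def) (blast intro: lstep_ext_weak)
next
  case (TProd a b)
  with assms(1,2,7,8) show ?thesis
    by (simp add: full_rel_def) (blast intro: lstep_ext_weak)
next
  case (TFun a b)
  with assms(1,2,4) show ?thesis
    by (simp add: full_rel_def) (blast intro: lstep_ext_weak)
next
  case (TMu a)
  with assms(1,2,9) show ?thesis
    by (simp add: full_rel_def) (blast intro: lstep_ext_weak)
qed

text \<open>Both terms have the same head symbol, so the right-hand side answers by the same rule.
  The targets are built from the stored arguments and the label, all of which are related by
  \<open>R\<close>.\<close>

lemma V_rel_Op:
  assumes wf: "wf_op f"
    and len: "length ts = length (op_dom f)" "length ss = length (op_dom f)"
    and args: "\<And>i. i < length (op_dom f) \<Longrightarrow> (ts ! i, ss ! i) \<in> R (op_dom f ! i)"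
  shows "(Op f ts, Op f ss) \<in> V_rel R R (op_cod f)"
proof (rule V_relI)
  show "Op f ts ::: op_cod f" "Op f ss ::: op_cod f"
    using wf len args by (auto intro!: has_type_Op dest: rel_typed)
  show "op_cod f \<noteq> TVar i" for i
    using wf by (rule op_cod_not_TVar)
next
  fix a b e1 e2 u
  assume cod: "op_cod f = TFun a b" and e: "(e1, e2) \<in> R a"
    and st: "lstep (Op f ts) (LArg e1) u"
  \<comment> \<open>The combinator rules require a well-typed label; for the answer with
    \<open>e2\<close> this comes from relatedness.\<close>
  note ty = rel_typed[OF e]
  from st show "\<exists>v. lstep (Op f ss) (LArg e2) v \<and> (u, v) \<in> R b"
  proof (cases rule: lstep_LArgE)
    case (S a' b' c')
    with cod wf len e ty rel_Op[of "OS1 a' b' c'" "[e1]" "[e2]"] show ?thesis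
      by (auto intro: lstep.S)
  next
    case (S1 a' b' c' t1)
    then obtain t2 where ss: "ss = [t2]" using len by (auto simp: length_Suc_conv)
    with S1 cod wf args[of 0] e ty rel_Op[of "OS2 a' b' c'" "[t1, e1]" "[t2, e2]"] show ?thesis
      by (auto intro: lstep.S1)
  next
    case (S2 a' b' c' t1 s1)
    then obtain t2 s2 where ss: "ss = [t2, s2]"
      using len by (auto simp: length_Suc_conv numeral_2_eq_2)
    \<comment> \<open>Three uses of congruence for application: one for each copy of the label, and
      one for the outer application.\<close>
    with S2 cod wf args[of 0] args[of 1] e
    have "(u, App b' c' (App a' (TFun b' c') t2 e2) (App a' b' s2 e2)) \<in> R b"
      by (auto intro!: rel_App)
    moreover have "lstep (Op f ss) (LArg e2) (App b' c' (App a' (TFun b' c') t2 e2) (App a' b' s2 e2))"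
      using S2 ss cod ty by (auto intro: lstep.S2)
    ultimately show ?thesis by blast
  next
    case (K a' b')
    with cod wf len e ty rel_Op[of "OK1 a' b'" "[e1]" "[e2]"] show ?thesis
      by (auto intro: lstep.K)
  next
    case (K1 b' a')
    then obtain t2 where ss: "ss = [t2]" using len by (auto simp: length_Suc_conv)
    with K1 cod args[of 0] ty show ?thesis by (auto intro: lstep.K1)
  next
    case (I a')
    with cod len e ty show ?thesis by (auto intro!: lstep.I)
  qed
next
  fix a b u
  assume "op_cod f = TSum a b" "lstep (Op f ts) LSum1 u"
  with len args[of 0] show "\<exists>v. lstep (Op f ss) LSum1 v \<and> (u, v) \<in> R a"
    by (auto elim!: lstep_LSum1E simp: length_Suc_conv intro!: exI conjI lstep.inl)
next
  fix a b u
  assume "op_cod f = TSum a b" "lstep (Op f ts) LSum2 u"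
  with len args[of 0] show "\<exists>v. lstep (Op f ss) LSum2 v \<and> (u, v) \<in> R b"
    by (auto elim!: lstep_LSum2E simp: length_Suc_conv intro!: exI conjI lstep.inr)
next
  fix a b u
  assume "op_cod f = TProd a b" "lstep (Op f ts) LProd1 u"
  with len args[of 0] show "\<exists>v. lstep (Op f ss) LProd1 v \<and> (u, v) \<in> R a"
    by (auto elim!: lstep_LProd1E simp: length_Suc_conv numeral_2_eq_2 intro!: exI conjI lstep.pair1)
next
  fix a b u
  assume "op_cod f = TProd a b" "lstep (Op f ts) LProd2 u"
  with len args[of 1] show "\<exists>v. lstep (Op f ss) LProd2 v \<and> (u, v) \<in> R b"
    by (auto elim!: lstep_LProd2E simp: length_Suc_conv numeral_2_eq_2 intro!: exI conjI lstep.pair2)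
next
  fix a u
  assume "op_cod f = TMu a" "lstep (Op f ts) LMu u"
  with len args[of 0] show "\<exists>v. lstep (Op f ss) LMu v \<and> (u, v) \<in> R (unroll a)"
    by (auto elim!: lstep_LMuE simp: length_Suc_conv intro!: exI conjI lstep.fold)
qed

text \<open>The form of the refined relation is that of \<open>M_fin (Suc n)\<close>, so this is the
  induction step for the finite stages.\<close>

lemma congruence_refine: "congruence (\<lambda>\<tau>. R \<tau> \<inter> E_rel R \<tau> \<inter> V_rel R R \<tau>)"
  unfolding congruence_def
proof (intro allI impI IntI; elim conjE)
  fix f ts ss
  assume wf: "wf_op f" and len: "length ts = length (op_dom f)" "length ss = length (op_dom f)"
    and args: "\<forall>i < length (op_dom f). ts ! i ::: op_dom f ! i \<and> ss ! i ::: op_dom f ! i \<and>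
      (ts ! i, ss ! i) \<in> R (op_dom f ! i) \<inter> E_rel R (op_dom f ! i) \<inter> V_rel R R (op_dom f ! i)"
  show "(Op f ts, Op f ss) \<in> R (op_cod f)"
    using wf len args by (auto intro!: rel_Op simp: list_all2_conv_all_nth)
  show "(Op f ts, Op f ss) \<in> E_rel R (op_cod f)"
    using args by (intro E_rel_Op[OF wf len]) blast
  show "(Op f ts, Op f ss) \<in> V_rel R R (op_cod f)"
    using args by (intro V_rel_Op[OF wf len]) blast
qed

end

section \<open>The finite stages and their intersection\<close>

lemma M_fin_typed: "M_fin n \<tau> \<subseteq> full_rel \<tau>"
  by (induction n) auto

lemma congruence_full: "congruence full_rel"
  by (auto simp: congruence_def full_rel_def intro!: has_type_Op)

lemma congruence_M_fin: "congruence (M_fin n)"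
proof (induction n)
  case 0
  show ?case by (simp add: congruence_full)
next
  case (Suc n)
  show ?case using congruence_refine[OF Suc M_fin_typed] by simp
qed

text \<open>Arguments related by the intersection are related by every member, and each member
  relates the resulting terms.\<close>

lemma congruence_INF:
  assumes "\<And>i. i \<in> A \<Longrightarrow> congruence (R i)"
  shows "congruence (\<lambda>\<tau>. \<Inter>i\<in>A. R i \<tau>)"
  unfolding congruence_def
proof (intro allI impI INT_I)
  fix f ts ss i
  assume "wf_op f \<and> length ts = length (op_dom f) \<and> length ss = length (op_dom f) \<and>
    (\<forall>j < length (op_dom f). ts ! j ::: op_dom f ! j \<and> ss ! j ::: op_dom f ! j \<and>
      (ts ! j, ss ! j) \<in> (\<Inter>i\<in>A. R i (op_dom f ! j)))" and "i \<in> A"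
  with assms[OF \<open>i \<in> A\<close>, unfolded congruence_def, rule_format, of f ts ss]
  show "(Op f ts, Op f ss) \<in> R i (op_cod f)" by simp
qed

theorem theorem3p11:
  fixes \<alpha> :: enat
  shows "congruence (M_rel \<alpha>)"
proof (cases \<alpha>)
  case (enat n)
  then have "M_rel \<alpha> = M_fin n" by (simp add: M_rel_def fun_eq_iff)
  then show ?thesis by (simp add: congruence_M_fin)
next
  case infinity
  \<comment> \<open>The stage at infinity is an intersection over all naturals, an instance of
    \<open>congruence_INF\<close>.\<close>
  then have "M_rel \<alpha> = (\<lambda>\<tau>. \<Inter>n. M_fin n \<tau>)" by (simp add: M_rel_def fun_eq_iff)
  then show ?thesis by (simp add: congruence_INF congruence_M_fin)
qed

end
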